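(* Let $G^{\varphi}$ be a conjugate skew gain graph whose underlying graph $G$ is finite, simple and connected. Then $G^{\varphi}$ is balanced and modulus-wise distance compatible if and only if the distance matrix $D(G^{\varphi})$ exists and is cospectral with $D(G^{|\varphi|})$ (that is, the two matrices have the same eigenvalues with the same multiplicities).
   Context: Conjugate skew gain graph (csg): for a graph $G=(V,E)$, $\overrightarrow{E}$ is the set of oriented edges, where each edge $uv\in E$ gives two oriented edges $\overrightarrow{uv}$ and $\overrightarrow{vu}$. A csg $G^{\varphi}$ is $G$ together with a function $\varphi:\overrightarrow{E}\to\mathbb{C}^{\times}=\mathbb{C}\setminus\{0\}$ satisfying $\varphi(\overrightarrow{vu})=\overline{\varphi(\overrightarrow{uv})}$. The gain $\varphi(\overrightarrow{P})$ of an oriented path $\overrightarrow{P}$ (resp. $\varphi(\overrightarrow{C})$ of an oriented cycle $\overrightarrow{C}$) is the product of the gains of its successive oriented edges. $G^{|\varphi|}$ denotes the csg on $G$ whose gain function is $\overrightarrow{uv}\mapsto|\varphi(\overrightarrow{uv})|$. Balance: $G^{\varphi}$ is balanced if $\varphi(\overrightarrow{C})=|\varphi(\overrightarrow{C})|$ for every oriented cycle $\overrightarrow{C}$. Compatibility: $G^{\varphi}$ is modulus-wise distance compatible if for every pair of distinct vertices $u,v$ and any two shortest oriented paths $\overrightarrow{P},\overrightarrow{Q}$ from $u$ to $v$, $|\varphi(\overrightarrow{P})|=|\varphi(\overrightarrow{Q})|$. Distance matrices: $d(u,v)$ is the graph distance in $G$. For distinct $u,v$ let $\mathcal{P}_{(u,v)}$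 be the set of shortest oriented paths from $u$ to $v$. Using the lexicographic order on $\mathbb{C}$ ($a+ib<c+id$ if $a<c$, or $a=c$ and $b<d$), let $\varphi^{\max}_{(u,v)}$ and $\varphi^{\min}_{(u,v)}$ be the maximum and minimum of $\{\varphi(\overrightarrow{P}):\overrightarrow{P}\in\mathcal{P}_{(u,v)}\}$. Put $d^{\max}(u,v)=\varphi^{\max}_{(u,v)}d(u,v)$, $d^{\min}(u,v)=\varphi^{\min}_{(u,v)}d(u,v)$ (diagonal entries $0$), $D^{\max}(G^{\varphi})=(d^{\max}(u,v))$ and $D^{\min}(G^{\varphi})=(d^{\min}(u,v))$. One says that $D(G^{\varphi})$ exists if $D^{\max}(G^{\varphi})=D^{\min}(G^{\varphi})$ (equivalently, for all distinct $u,v$ all shortest oriented paths from $u$ to $v$ have the same gain), and then $D(G^{\varphi})$ denotes this common matrix. When $D(G^{\varphi})$ exists, so does $D(G^{|\varphi|})$. *)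

theory Defs
  imports
    "Graph_Theory.Graph_Theory"
    "Jordan_Normal_Form.Char_Poly"
begin

text \<open>
  A finite simple graph is a finite, loop-free, symmetric digraph whose arcs are ordered pairs
  of vertices: the arcs (u, v) and (v, u) are the two orientations of the edge uv. Gain functions
  are total on pairs; only their values on arcs are ever used.
\<close>

locale conj_skew_gain_graph = pair_graph G for G :: "'a pair_pre_digraph" +
  fixes \<phi> :: "'a \<times> 'a \<Rightarrow> complex"
  assumes gain_nonzero: "e \<in> parcs G \<Longrightarrow> \<phi> e \<noteq> 0"
    and gain_conj: "(u, v) \<in> parcs G \<Longrightarrow> \<phi> (v, u) = cnj (\<phi> (u, v))"

definition gain :: "('a \<times> 'a \<Rightarrow> complex) \<Rightarrow> ('a \<times> 'a) awalk \<Rightarrow> complex" where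
  "gain \<phi> p = prod_list (map \<phi> p)"

definition abs_gain_fun :: "('a \<times> 'a \<Rightarrow> complex) \<Rightarrow> 'a \<times> 'a \<Rightarrow> complex" where
  "abs_gain_fun \<phi> = (\<lambda>e. complex_of_real (cmod (\<phi> e)))"

text \<open>
  The library's directed cycles include the walk u, v, u along both orientations of one edge,
  which is not a cycle of the undirected graph; hence the bound on the length.
\<close>

definition oriented_cycle :: "'a pair_pre_digraph \<Rightarrow> ('a \<times> 'a) awalk \<Rightarrow> bool" where
  "oriented_cycle G c \<longleftrightarrow> pre_digraph.cycle (with_proj G) c \<and> length c \<ge> 3"

definition balanced :: "'a pair_pre_digraph \<Rightarrow> ('a \<times> 'a \<Rightarrow> complex) \<Rightarrow> bool" where
  "balanced G \<phi> \<longleftrightarrow>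
    (\<forall>c. oriented_cycle G c \<longrightarrow> gain \<phi> c = complex_of_real (cmod (gain \<phi> c)))"

definition graph_dist :: "'a pair_pre_digraph \<Rightarrow> 'a \<Rightarrow> 'a \<Rightarrow> nat" where
  "graph_dist G u v = (LEAST n. \<exists>p. pre_digraph.apath (with_proj G) u p v \<and> length p = n)"

definition shortest_paths :: "'a pair_pre_digraph \<Rightarrow> 'a \<Rightarrow> 'a \<Rightarrow> ('a \<times> 'a) awalk set" where
  "shortest_paths G u v =
    {p. pre_digraph.apath (with_proj G) u p v \<and> length p = graph_dist G u v}"

definition modulus_distance_compatible ::
    "'a pair_pre_digraph \<Rightarrow> ('a \<times> 'a \<Rightarrow> complex) \<Rightarrow> bool" where
  "modulus_distance_compatible G \<phi> \<longleftrightarrow>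
    (\<forall>u \<in> pverts G. \<forall>v \<in> pverts G. u \<noteq> v \<longrightarrow>
      (\<forall>p \<in> shortest_paths G u v. \<forall>q \<in> shortest_paths G u v.
        cmod (gain \<phi> p) = cmod (gain \<phi> q)))"

definition lex_le :: "complex \<Rightarrow> complex \<Rightarrow> bool" where
  "lex_le z w \<longleftrightarrow> Re z < Re w \<or> Re z = Re w \<and> Im z \<le> Im w"

definition lex_Max :: "complex set \<Rightarrow> complex" where
  "lex_Max S = (THE z. z \<in> S \<and> (\<forall>w \<in> S. lex_le w z))"

definition lex_Min :: "complex set \<Rightarrow> complex" where
  "lex_Min S = (THE z. z \<in> S \<and> (\<forall>w \<in> S. lex_le z w))"

definition dist_max ::
    "'a pair_pre_digraph \<Rightarrow> ('a \<times> 'a \<Rightarrow> complex) \<Rightarrow> 'a \<Rightarrow> 'a \<Rightarrow> complex" where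
  "dist_max G \<phi> u v =
    (if u = v then 0 else lex_Max (gain \<phi> ` shortest_paths G u v) * of_nat (graph_dist G u v))"

definition dist_min ::
    "'a pair_pre_digraph \<Rightarrow> ('a \<times> 'a \<Rightarrow> complex) \<Rightarrow> 'a \<Rightarrow> 'a \<Rightarrow> complex" where
  "dist_min G \<phi> u v =
    (if u = v then 0 else lex_Min (gain \<phi> ` shortest_paths G u v) * of_nat (graph_dist G u v))"

text \<open>The list \<open>vs\<close> enumerates the vertices and fixes the order of rows and columns.\<close>

definition Dmax ::
    "'a pair_pre_digraph \<Rightarrow> 'a list \<Rightarrow> ('a \<times> 'a \<Rightarrow> complex) \<Rightarrow> complex mat" where
  "Dmax G vs \<phi> =
    mat (length vs) (length vs) (\<lambda>(i, j). dist_max G \<phi> (vs ! i) (vs ! j))"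

definition Dmin ::
    "'a pair_pre_digraph \<Rightarrow> 'a list \<Rightarrow> ('a \<times> 'a \<Rightarrow> complex) \<Rightarrow> complex mat" where
  "Dmin G vs \<phi> =
    mat (length vs) (length vs) (\<lambda>(i, j). dist_min G \<phi> (vs ! i) (vs ! j))"

definition D_exists ::
    "'a pair_pre_digraph \<Rightarrow> 'a list \<Rightarrow> ('a \<times> 'a \<Rightarrow> complex) \<Rightarrow> bool" where
  "D_exists G vs \<phi> \<longleftrightarrow> Dmax G vs \<phi> = Dmin G vs \<phi>"

text \<open>The common value of the two matrices; meaningful only under \<^const>\<open>D_exists\<close>.\<close>

definition Dmat ::
    "'a pair_pre_digraph \<Rightarrow> 'a list \<Rightarrow> ('a \<times> 'a \<Rightarrow> complex) \<Rightarrow> complex mat" where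
  "Dmat G vs \<phi> = Dmax G vs \<phi>"

text \<open>
  Same eigenvalues with the same algebraic multiplicities. The distance matrices
  compared here are Hermitian, so algebraic and geometric multiplicities agree.
\<close>

definition cospectral :: "complex mat \<Rightarrow> complex mat \<Rightarrow> bool" where
  "cospectral A B \<longleftrightarrow>
    (\<forall>k. (eigenvalue A k \<longleftrightarrow> eigenvalue B k) \<and>
         Polynomial.order k (char_poly A) = Polynomial.order k (char_poly B))"

end

theory Submission
  imports Defs "Jordan_Normal_Form.Schur_Decomposition"
begin

text \<open>
  If the graph is balanced, every closed walk has positive gain, so the phase of the gain of a walk
  depends only on its end points and is a quotient \<open>\<zeta> v / \<zeta> u\<close>. With modulus-wise compatibility the
  distance matrix exists, and conjugation by the diagonal matrix of \<open>\<zeta>\<close> turns it into the distance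
  matrix of the moduli.

  Conversely, write \<open>A\<close> for the distance matrix and \<open>|A|\<close> for its entrywise modulus, which is the
  distance matrix of the moduli. Cospectrality gives \<open>tr (A\<^sup>k) = tr (|A|\<^sup>k)\<close> for all \<open>k\<close>. Both sides
  are sums over closed index walks of length \<open>k\<close>, and the terms on the right are the moduli of those on
  the left; by the equality case of the triangle inequality every closed walk product of \<open>A\<close> is a
  nonnegative real. Entries of \<open>A\<close> at arcs are the gains, so this applies to the gain of each cycle.
\<close>

subsection \<open>Traces of powers and cospectrality\<close>

definition mat_trace :: "'a::comm_ring_1 mat \<Rightarrow> 'a" where
  "mat_trace A = (\<Sum>i<dim_row A. A $$ (i, i))"

lemma mat_trace_mult_commute:
  assumes "A \<in> carrier_mat n m" "B \<in> carrier_mat m n"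
  shows "mat_trace (A * B) = mat_trace (B * A)"
proof -
  have "mat_trace (A * B) = (\<Sum>i<n. \<Sum>j<m. A $$ (i, j) * B $$ (j, i))"
    using assms by (auto simp: mat_trace_def scalar_prod_def lessThan_atLeast0 intro!: sum.cong)
  also have "\<dots> = (\<Sum>j<m. \<Sum>i<n. B $$ (j, i) * A $$ (i, j))"
    by (subst sum.swap) (simp add: mult.commute)
  also have "\<dots> = mat_trace (B * A)"
    using assms by (auto simp: mat_trace_def scalar_prod_def lessThan_atLeast0 intro!: sum.cong)
  finally show ?thesis .
qed

lemma mat_trace_similar:
  assumes "similar_mat_wit A B P Q"
  shows "mat_trace A = mat_trace B"
proof -
  define n where "n = dim_row A"
  note w = similar_mat_witD[OF n_def assms]
  have "mat_trace (P * B * Q) = mat_trace (Q * (P * B))"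
    by (rule mat_trace_mult_commute[of _ n n]) (use w(5-7) in auto)
  also have "Q * (P * B) = B"
    using w(2,5) assoc_mult_mat[OF w(7,6,5)] left_mult_one_mat[OF w(5)] by simp
  finally show ?thesis unfolding w(3)[symmetric] .
qed

text \<open>The restriction to \<open>j \<le> i\<close> suits the induction: in the sum for the next
  power, terms with \<open>l < i\<close> vanish by the induction hypothesis, and terms with
  \<open>l > i\<close> vanish because then \<open>j < l\<close> and \<open>B\<close> is upper
  triangular.\<close>

lemma pow_mat_upper_triangular:
  fixes B :: "'a::comm_ring_1 mat"
  assumes B: "B \<in> carrier_mat n n" and ut: "upper_triangular B" and "i < n" "j \<le> i"
  shows "(B ^\<^sub>m k) $$ (i, j) = (if i = j then B $$ (i, i) ^ k else 0)"
  using assms(3,4)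
proof (induction k arbitrary: j)
  case 0
  then show ?case using B by auto
next
  case (Suc k)
  have "(B ^\<^sub>m Suc k) $$ (i, j) = (\<Sum>l<n. (B ^\<^sub>m k) $$ (i, l) * B $$ (l, j))"
    using B Suc.prems pow_carrier_mat[OF B, of k]
    by (auto simp: scalar_prod_def lessThan_atLeast0 intro!: sum.cong)
  also have "\<dots> = (\<Sum>l<n. if l = i then B $$ (i, i) ^ k * B $$ (i, j) else 0)"
  proof (rule sum.cong[OF refl])
    fix l assume "l \<in> {..<n}"
    then show "(B ^\<^sub>m k) $$ (i, l) * B $$ (l, j) = (if l = i then B $$ (i, i) ^ k * B $$ (i, j) else 0)"
      using Suc.IH[of l] Suc.prems upper_triangularD[OF ut, of j l] B
      by (cases l i rule: linorder_cases) auto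
  qed
  also have "\<dots> = B $$ (i, i) ^ k * B $$ (i, j)"
    using Suc.prems by simp
  also have "\<dots> = (if i = j then B $$ (i, i) ^ Suc k else 0)"
    using upper_triangularD[OF ut, of j i] B Suc.prems by (auto simp: mult.commute)
  finally show ?case .
qed

text \<open>By Schur triangularization \<open>A\<close> is similar to an upper triangular matrix
  with diagonal \<open>es\<close>. Traces of powers survive similarity, so they are the power sums
  of the eigenvalues counted with algebraic multiplicity.\<close>

lemma mat_trace_pow:
  fixes A :: "complex mat"
  assumes A: "A \<in> carrier_mat n n" and c: "char_poly A = (\<Prod>e\<leftarrow>es. [:- e, 1:])"
  shows "mat_trace (A ^\<^sub>m k) = (\<Sum>e\<leftarrow>es. e ^ k)"
proof -
  obtain B P Q where BPQ: "schur_decomposition A es = (B, P, Q)"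
    by (cases "schur_decomposition A es")
  from schur_decomposition[OF A c BPQ]
  have sim: "similar_mat_wit A B P Q" and ut: "upper_triangular B" and es: "diag_mat B = es"
    by auto
  have B: "B \<in> carrier_mat n n" using similar_mat_witD2[OF A sim] by auto
  have "mat_trace (A ^\<^sub>m k) = mat_trace (B ^\<^sub>m k)"
    by (rule mat_trace_similar[OF similar_mat_wit_pow[OF sim]])
  also have "\<dots> = (\<Sum>i<n. B $$ (i, i) ^ k)"
    using pow_mat_upper_triangular[OF B ut] pow_carrier_mat[OF B, of k]
    by (auto simp: mat_trace_def)
  also have "\<dots> = (\<Sum>e\<leftarrow>diag_mat B. e ^ k)"
    using B by (simp add: diag_mat_def o_def interv_sum_list_conv_sum_set_nat lessThan_atLeast0)
  finally show ?thesis by (simp add: es)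
qed

lemma order_prod_list_linear:
  "Polynomial.order x (\<Prod>e\<leftarrow>es. [:- e, 1:]) = count_list es (x :: 'a::field)"
proof (induction es)
  case (Cons e es)
  have "(\<Prod>e\<leftarrow>es. [:- e, 1:]) \<noteq> 0"
    by (auto simp: prod_list_zero_iff)
  then show ?case
    using Cons by (auto simp: order_mult order_linear' simp del: mult_pCons_left)
qed (simp add: order_0I)

text \<open>The order of a root of the characteristic polynomial is its count in the list of linear
  factors. Equal orders therefore make the two lists of eigenvalues permutations of each other, with
  the same power sums.\<close>

lemma cospectral_mat_trace_pow:
  assumes A: "A \<in> carrier_mat n n" and B: "B \<in> carrier_mat n n" and "cospectral A B"
  shows "mat_trace (A ^\<^sub>m k) = mat_trace (B ^\<^sub>m k)"
proof -
  obtain as bs where as: "char_poly A = (\<Prod>e\<leftarrow>as. [:- e, 1:])"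
    and bs: "char_poly B = (\<Prod>e\<leftarrow>bs. [:- e, 1:])"
    using char_poly_factorized[OF A] char_poly_factorized[OF B] by blast
  have "count_list as x = count_list bs x" for x
    using assms(3) unfolding cospectral_def as bs order_prod_list_linear by auto
  then have "mset as = mset bs"
    by (intro multiset_eqI) (simp add: count_mset)
  then have "(\<Sum>e\<leftarrow>as. e ^ k) = (\<Sum>e\<leftarrow>bs. e ^ k)"
    by (metis mset_map sum_mset_sum_list)
  then show ?thesis
    by (simp add: mat_trace_pow[OF A as] mat_trace_pow[OF B bs])
qed

lemma cospectral_similar:
  assumes "similar_mat A B"
  shows "cospectral A B"
proof -
  from similar_matD[OF assms] obtain n where "A \<in> carrier_mat n n" "B \<in> carrier_mat n n"
    by auto
  then show ?thesis
    using char_poly_similar[OF assms] by (auto simp: cospectral_def eigenvalue_root_char_poly)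
qed

subsection \<open>Equality of traces with the entrywise modulus\<close>

text \<open>Equality case of the triangle inequality. After rotation by \<open>cnj u\<close> each
  real part is at most \<open>r l\<close> while the sums agree, so each real part equals
  \<open>r l\<close>; the bound on the modulus then leaves no room for an imaginary part. The bound
  \<open>r l\<close> may exceed the modulus a priori, since an entry of a power of
  \<open>abs_mat A\<close> only dominates the corresponding entry of the power of
  \<open>A\<close>.\<close>

lemma sum_eq_unimodular_mult_sum_bound:
  fixes x :: "'a \<Rightarrow> complex"
  assumes "finite S" and le: "\<And>l. l \<in> S \<Longrightarrow> cmod (x l) \<le> r l"
    and u: "cmod u = 1" and eq: "(\<Sum>l\<in>S. x l) = u * of_real (\<Sum>l\<in>S. r l)" and l: "l \<in> S"
  shows "x l = u * of_real (r l)"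
proof -
  have uu: "cnj u * u = 1" "u * cnj u = 1"
    using u complex_norm_square[of u] by (simp_all add: mult.commute)
  have cm: "cmod (cnj u * x m) \<le> r m" if "m \<in> S" for m
    using le[OF that] u by (simp add: norm_mult)
  have "(\<Sum>l\<in>S. cnj u * x l) = of_real (\<Sum>l\<in>S. r l)"
    unfolding sum_distrib_left[symmetric] eq mult.assoc[symmetric] uu by simp
  from arg_cong[OF this, of Re]
  have sum_Re: "(\<Sum>l\<in>S. Re (cnj u * x l)) = (\<Sum>l\<in>S. r l)"
    by (simp only: Re_sum Re_complex_of_real)
  have le': "Re (cnj u * x m) \<le> r m" if "m \<in> S" for m
    by (rule order_trans[OF complex_Re_le_cmod cm[OF that]])
  have Re: "Re (cnj u * x l) = r l"
    by (rule sum_mono_inv[OF sum_Re le' l \<open>finite S\<close>])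
  then have "(Im (cnj u * x l))\<^sup>2 \<le> 0"
    using power_mono[OF cm[OF l] norm_ge_zero, of 2]
    unfolding cmod_power2[of "cnj u * x l"] by (simp only: add_le_same_cancel1)
  then have "Im (cnj u * x l) = 0" by simp
  with Re have "cnj u * x l = of_real (r l)" 
    by (simp only: complex_eq_iff Re_complex_of_real Im_complex_of_real)
  then have "u * cnj u * x l = u * of_real (r l)" by (simp only: mult.assoc)
  then show ?thesis by (simp only: uu mult_1)
qed

definition abs_mat :: "complex mat \<Rightarrow> complex mat" where
  "abs_mat A = map_mat (\<lambda>z. complex_of_real (cmod z)) A"

lemma abs_mat_carrier: "A \<in> carrier_mat n m \<Longrightarrow> abs_mat A \<in> carrier_mat n m"
  by (simp add: abs_mat_def)

lemma index_pow_mat_Suc: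
  assumes "A \<in> carrier_mat n n" "i < n" "j < n"
  shows "(A ^\<^sub>m Suc k) $$ (i, j) = (\<Sum>l<n. (A ^\<^sub>m k) $$ (i, l) * A $$ (l, j))"
  using assms pow_carrier_mat[OF assms(1), of k]
  by (auto simp: scalar_prod_def lessThan_atLeast0 intro!: sum.cong)

text \<open>Triangle inequality, applied once per matrix multiplication. The witness
  \<open>r\<close> records that the dominating complex entry is real.\<close>

lemma abs_mat_pow_dominates:
  assumes A: "A \<in> carrier_mat n n" and "i < n" "j < n"
  shows "\<exists>r. (abs_mat A ^\<^sub>m k) $$ (i, j) = complex_of_real r \<and> cmod ((A ^\<^sub>m k) $$ (i, j)) \<le> r"
  using assms(2,3)
proof (induction k arbitrary: j)
  case 0
  then show ?case using A by (auto simp: abs_mat_def intro!: exI[of _ "if i = j then 1 else 0"])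
next
  case (Suc k)
  from Suc.IH Suc.prems have "\<forall>l\<in>{..<n}. \<exists>r. (abs_mat A ^\<^sub>m k) $$ (i, l) = complex_of_real r
      \<and> cmod ((A ^\<^sub>m k) $$ (i, l)) \<le> r"
    by auto
  then obtain r where r: "\<And>l. l < n \<Longrightarrow> (abs_mat A ^\<^sub>m k) $$ (i, l) = complex_of_real (r l)"
    "\<And>l. l < n \<Longrightarrow> cmod ((A ^\<^sub>m k) $$ (i, l)) \<le> r l"
    by (metis lessThan_iff)
  have "(abs_mat A ^\<^sub>m Suc k) $$ (i, j) = of_real (\<Sum>l<n. r l * cmod (A $$ (l, j)))"
    using A Suc.prems r
    by (subst index_pow_mat_Suc[OF abs_mat_carrier[OF A]]) (auto simp: abs_mat_def intro!: sum.cong)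
  moreover have "cmod ((A ^\<^sub>m Suc k) $$ (i, j)) \<le> (\<Sum>l<n. r l * cmod (A $$ (l, j)))"
    unfolding index_pow_mat_Suc[OF A Suc.prems]
    using r by (intro sum_norm_le) (auto simp: norm_mult intro!: mult_right_mono)
  ultimately show ?case by blast
qed

text \<open>
  Equality in the triangle inequality for one entry of \<open>A ^\<^sub>m Suc k\<close> passes to the entries of
  \<open>A ^\<^sub>m k\<close>, with a changed phase \<open>u\<close>; hence the general \<open>u\<close>, although only \<open>u = 1\<close> matters.
\<close>

lemma walk_product_phase:
  assumes A: "A \<in> carrier_mat n n" and f: "\<And>t. t \<le> k \<Longrightarrow> f t < n" and u: "cmod u = 1"
    and eq: "(A ^\<^sub>m k) $$ (f 0, f k) = u * (abs_mat A ^\<^sub>m k) $$ (f 0, f k)"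
  shows "(\<Prod>t<k. A $$ (f t, f (Suc t))) = u * of_real (cmod (\<Prod>t<k. A $$ (f t, f (Suc t))))"
  using f u eq
proof (induction k arbitrary: u)
  case 0
  then show ?case using A abs_mat_carrier[OF A] by simp
next
  case (Suc k)
  define i j where "i = f 0" and "j = f (Suc k)"
  have ij: "i < n" "j < n" using Suc.prems(1) by (auto simp: i_def j_def)
  define z where "z = A $$ (f k, j)"
  show ?case
  \<comment> \<open>If the last factor is zero, so is the whole product, and both sides vanish.
    Otherwise this factor can be divided out.\<close>
  proof (cases "z = 0")
    case True
    then show ?thesis by (simp add: z_def j_def)
  next
    case False
    have "\<forall>l\<in>{..<n}. \<exists>r. (abs_mat A ^\<^sub>m k) $$ (i, l) = complex_of_real r
      \<and> cmod ((A ^\<^sub>m k) $$ (i, l)) \<le> r"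
      using abs_mat_pow_dominates[OF A ij(1)] by simp
    then obtain r where r: "\<And>l. l < n \<Longrightarrow> (abs_mat A ^\<^sub>m k) $$ (i, l) = complex_of_real (r l)"
      "\<And>l. l < n \<Longrightarrow> cmod ((A ^\<^sub>m k) $$ (i, l)) \<le> r l"
      by (metis lessThan_iff)
    have "(abs_mat A ^\<^sub>m Suc k) $$ (i, j) = of_real (\<Sum>l<n. r l * cmod (A $$ (l, j)))"
      using A ij r
      by (subst index_pow_mat_Suc[OF abs_mat_carrier[OF A]]) (auto simp: abs_mat_def intro!: sum.cong)
    then have eq: "(\<Sum>l<n. (A ^\<^sub>m k) $$ (i, l) * A $$ (l, j))
        = u * of_real (\<Sum>l<n. r l * cmod (A $$ (l, j)))"
      using Suc.prems(3) index_pow_mat_Suc[OF A ij] by (simp add: i_def j_def)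
    \<comment> \<open>Equality of the sums forces equality of each summand, in particular of the one
      whose last step starts at \<open>f k\<close>. Dividing by \<open>z\<close> leaves the shorter
      walk with phase \<open>u / sgn z\<close>.\<close>
    have "(A ^\<^sub>m k) $$ (i, f k) * z = u * of_real (r (f k) * cmod z)"
      unfolding z_def using Suc.prems(1)[of k]
      by (intro sum_eq_unimodular_mult_sum_bound[OF _ _ Suc.prems(2) eq])
        (auto simp: norm_mult intro!: mult_right_mono r)
    moreover have zs: "z = sgn z * of_real (cmod z)" and sz: "cmod (sgn z) = 1"
      using False by (auto simp: sgn_eq norm_divide)
    ultimately have "(A ^\<^sub>m k) $$ (i, f k) = (u / sgn z) * of_real (r (f k))"
      using False by (auto simp: sgn_eq field_simps)
    then have "(A ^\<^sub>m k) $$ (f 0, f k) = (u / sgn z) * (abs_mat A ^\<^sub>m k) $$ (f 0, f k)"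
      using r(1)[of "f k"] Suc.prems(1)[of k] by (simp add: i_def)
    then have "(\<Prod>t<k. A $$ (f t, f (Suc t)))
        = (u / sgn z) * of_real (cmod (\<Prod>t<k. A $$ (f t, f (Suc t))))"
      using Suc.prems sz by (intro Suc.IH) (auto simp: norm_divide)
    then have "(\<Prod>t<k. A $$ (f t, f (Suc t))) * (sgn z * of_real (cmod z))
        = u * of_real (cmod (\<Prod>t<k. A $$ (f t, f (Suc t)))) * of_real (cmod z)"
      using False by (simp add: sgn_zero_iff field_simps)
    then have "(\<Prod>t<k. A $$ (f t, f (Suc t))) * z
        = u * of_real (cmod (\<Prod>t<k. A $$ (f t, f (Suc t))) * cmod z)"
      unfolding zs[symmetric] by (simp only: of_real_mult mult.assoc)
    then have "(\<Prod>t<k. A $$ (f t, f (Suc t))) * z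
        = u * of_real (cmod ((\<Prod>t<k. A $$ (f t, f (Suc t))) * z))"
      unfolding norm_mult[symmetric] .
    then show ?thesis by (simp add: z_def j_def)
  qed
qed

text \<open>Equal traces are equal sums of diagonal entries, one side dominating the other term by
  term; so the entries at \<open>(f 0, f 0)\<close> agree. A closed walk contributes to exactly such
  an entry, and \<open>walk_product_phase\<close> applies with \<open>u = 1\<close>.\<close>

lemma closed_walk_product_nonneg:
  assumes A: "A \<in> carrier_mat n n"
    and tr: "mat_trace (A ^\<^sub>m k) = mat_trace (abs_mat A ^\<^sub>m k)"
    and f: "\<And>t. t \<le> k \<Longrightarrow> f t < n" and closed: "f k = f 0"
  shows "(\<Prod>t<k. A $$ (f t, f (Suc t))) = of_real (cmod (\<Prod>t<k. A $$ (f t, f (Suc t))))"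
proof -
  have "\<forall>l\<in>{..<n}. \<exists>r. (abs_mat A ^\<^sub>m k) $$ (l, l) = complex_of_real r
    \<and> cmod ((A ^\<^sub>m k) $$ (l, l)) \<le> r"
    using abs_mat_pow_dominates[OF A] by simp
  then obtain r where r: "\<And>l. l < n \<Longrightarrow> (abs_mat A ^\<^sub>m k) $$ (l, l) = complex_of_real (r l)"
    "\<And>l. l < n \<Longrightarrow> cmod ((A ^\<^sub>m k) $$ (l, l)) \<le> r l"
    by (metis lessThan_iff)
  have "(\<Sum>l<n. (A ^\<^sub>m k) $$ (l, l)) = 1 * of_real (\<Sum>l<n. r l)"
    using tr r(1) pow_carrier_mat[OF A, of k] pow_carrier_mat[OF abs_mat_carrier[OF A], of k]
    by (simp add: mat_trace_def carrier_matD[OF A] carrier_matD[OF abs_mat_carrier[OF A]])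
  then have "(A ^\<^sub>m k) $$ (f 0, f 0) = 1 * of_real (r (f 0))"
    by (rule sum_eq_unimodular_mult_sum_bound[rotated 3]) (use r f[of 0] in auto)
  then have "(A ^\<^sub>m k) $$ (f 0, f k) = 1 * (abs_mat A ^\<^sub>m k) $$ (f 0, f k)"
    using r(1) f[of 0] closed by simp
  from walk_product_phase[OF A f _ this] show ?thesis by simp
qed

section \<open>Phases, gains and the lexicographic order\<close>

lemma sgn_eq_1_iff: "z \<noteq> 0 \<Longrightarrow> sgn z = 1 \<longleftrightarrow> z = complex_of_real (cmod z)"
  by (simp add: sgn_eq)

lemma gain_Nil [simp]: "gain \<phi> [] = 1"
  and gain_Cons [simp]: "gain \<phi> (e # p) = \<phi> e * gain \<phi> p"
  and gain_append [simp]: "gain \<phi> (p @ q) = gain \<phi> p * gain \<phi> q"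
  by (simp_all add: gain_def)

lemma gain_abs_gain_fun: "gain (abs_gain_fun \<phi>) p = complex_of_real (cmod (gain \<phi> p))"
  by (induction p) (simp_all add: abs_gain_fun_def norm_mult)

text \<open>Justifies the definite descriptions in \<open>lex_Max\<close> and
  \<open>lex_Min\<close>. The relation is left abstract so that the reversed order yields the
  minimum.\<close>

lemma finite_ex1_greatest:
  assumes "finite S" "S \<noteq> {}"
    and total: "\<And>x y. R x y \<or> R y x"
    and trans: "\<And>x y z. R x y \<Longrightarrow> R y z \<Longrightarrow> R x z"
    and antisym: "\<And>x y. R x y \<Longrightarrow> R y x \<Longrightarrow> x = y"
  shows "\<exists>!z. z \<in> S \<and> (\<forall>w\<in>S. R w z)"
proof -
  have "\<exists>z\<in>S. \<forall>w\<in>S. R w z"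
    using assms(1,2)
  proof (induction rule: finite_ne_induct)
    case (singleton x)
    then show ?case using total[of x x] by blast
  next
    case (insert x F)
    then obtain z where z: "z \<in> F" "\<forall>w\<in>F. R w z" by blast
    show ?case
    proof (cases "R x z")
      case False
      then have "R z x" using total by blast
      then have "\<forall>w\<in>insert x F. R w x" using z total trans by blast
      then show ?thesis by blast
    qed (use z in blast)
  qed
  then show ?thesis using antisym by blast
qed

lemma lex_le_total: "lex_le z w \<or> lex_le w z"
  by (simp add: lex_le_def) linarith

lemma lex_le_trans: "lex_le x y \<Longrightarrow> lex_le y z \<Longrightarrow> lex_le x z"
  unfolding lex_le_def by linarith

lemma lex_le_antisym: "lex_le z w \<Longrightarrow> lex_le w z \<Longrightarrow> z = w"
  unfolding lex_le_def complex_eq_iff by linarith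

lemma
  assumes "finite S" "S \<noteq> {}"
  shows lex_Max_in: "lex_Max S \<in> S" and lex_Max_ge: "w \<in> S \<Longrightarrow> lex_le w (lex_Max S)"
proof -
  have "\<exists>!z. z \<in> S \<and> (\<forall>w\<in>S. lex_le w z)"
    by (rule finite_ex1_greatest[OF assms])
      (fact lex_le_total, fact lex_le_trans, fact lex_le_antisym)
  from theI'[OF this, folded lex_Max_def]
  show "lex_Max S \<in> S" "w \<in> S \<Longrightarrow> lex_le w (lex_Max S)" by auto
qed

lemma
  assumes "finite S" "S \<noteq> {}"
  shows lex_Min_in: "lex_Min S \<in> S" and lex_Min_le: "w \<in> S \<Longrightarrow> lex_le (lex_Min S) w"
proof -
  have "\<exists>!z. z \<in> S \<and> (\<forall>w\<in>S. lex_le z w)"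
    by (rule finite_ex1_greatest[OF assms, of "\<lambda>w z. lex_le z w"])
      (fact lex_le_total, blast intro: lex_le_trans, blast intro: lex_le_antisym)
  from theI'[OF this, folded lex_Min_def]
  show "lex_Min S \<in> S" "w \<in> S \<Longrightarrow> lex_le (lex_Min S) w" by auto
qed

lemma lex_Max_eq_lex_Min_iff:
  assumes "finite S" "S \<noteq> {}"
  shows "lex_Max S = lex_Min S \<longleftrightarrow> (\<forall>z\<in>S. \<forall>w\<in>S. z = w)"
proof
  assume eq: "lex_Max S = lex_Min S"
  have "z = lex_Max S" if "z \<in> S" for z
    using lex_Max_ge[OF assms that] lex_Min_le[OF assms that]
    unfolding eq[symmetric] by (rule lex_le_antisym)
  then show "\<forall>z\<in>S. \<forall>w\<in>S. z = w" by metis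
qed (use lex_Max_in[OF assms] lex_Min_in[OF assms] in blast)

subsection \<open>Gains of walks and distance matrices\<close>

context conj_skew_gain_graph
begin

lemma gain_awalk_nonzero: "awalk u p v \<Longrightarrow> gain \<phi> p \<noteq> 0"
  using gain_nonzero by (induction p arbitrary: u) (auto simp: awalk_Cons_iff)

text \<open>Induction on the length: a closed walk is empty, an oriented cycle, an edge traversed
  back and forth, or splits at a repeated vertex into two shorter closed walks.\<close>

lemma sgn_gain_closed_awalk:
  assumes bal: "balanced G \<phi>" and "awalk u p u"
  shows "sgn (gain \<phi> p) = 1"
  using assms(2)
proof (induction "length p" arbitrary: u p rule: less_induct)
  case less
  show ?case
  proof (cases p)
    case (Cons e p')
    show ?thesis
    proof (cases "distinct (tl (awalk_verts u p))")
      case True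
      then have cyc: "cycle p" using less.prems Cons by (auto simp: cycle_def)
      show ?thesis
      proof (cases "length p \<ge> 3")
        case True
        then show ?thesis
          using bal cyc gain_awalk_nonzero[OF less.prems]
          by (simp add: sgn_eq_1_iff balanced_def oriented_cycle_def)
      next
        case False
        moreover have "2 \<le> length p" using cyc by (auto simp: cycle_digraph_conv)
        ultimately obtain e' where "p = [e, e']"
          using Cons by (cases p'; cases "tl p'") auto
        then obtain v where p: "p = [(u, v), (v, u)]" and uv: "(u, v) \<in> parcs G"
          using less.prems by (cases e, cases e') (auto simp: awalk_Cons_iff awalk_Nil_iff)
        \<comment> \<open>This walk is too short to be an \<open>oriented_cycle\<close>, so balance
          does not cover it; conjugate skewness makes its gain a squared modulus.\<close>
        have "gain \<phi> p = \<phi> (u, v) * cnj (\<phi> (u, v))"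
          using gain_conj[OF uv] by (simp add: p)
        also have "\<dots> = complex_of_real ((cmod (\<phi> (u, v)))\<^sup>2)"
          by (rule complex_norm_square[symmetric])
        finally show ?thesis
          using gain_nonzero[OF uv] by (subst sgn_eq_1_iff) (simp_all add: norm_power)
      qed
    next
      case False
      have e: "e \<in> parcs G" "u = fst e" and p': "awalk (snd e) p' u"
        using less.prems by (auto simp: Cons awalk_Cons_iff)
      moreover have "\<not> distinct (awalk_verts (snd e) p')"
        using False by (simp add: Cons)
      \<comment> \<open>The segment \<open>r\<close> is a closed walk at the repeated vertex
        \<open>w\<close>. It is nonempty and misses \<open>e\<close>, so both \<open>r\<close> and
        the walk left after cutting it out are shorter than \<open>p\<close>.\<close>
      ultimately obtain q r s w where qrs: "p' = q @ r @ s" "0 < length r"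
        "awalk (snd e) q w" "awalk w r w" "awalk w s u"
        using awalk_not_distinct_decomp[OF p'] by blast
      have "awalk u (e # q @ s) u"
        using e qrs by (auto simp: awalk_Cons_iff)
      then have "sgn (gain \<phi> (e # q @ s)) = 1"
        using qrs by (intro less.hyps) (auto simp: Cons)
      moreover have "sgn (gain \<phi> r) = 1"
        using qrs by (intro less.hyps) (auto simp: Cons)
      ultimately show ?thesis
        by (simp add: Cons qrs(1) sgn_mult mult.left_commute)
    qed
  qed simp
qed

text \<open>Connectedness is defined through the symmetric closure, which has the same reachability
  here because the arcs are already symmetric.\<close>

lemma connected_awalk:
  assumes "connected G" "u \<in> pverts G" "v \<in> pverts G"
  shows "\<exists>p. awalk u p v"
  using assms reachable_mk_symmetric_eq[OF pair_sym_arcs, of u v]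
  by (auto simp: connected_def strongly_connected_def reachable_awalk)

lemma balanced_potential:
  assumes bal: "balanced G \<phi>" and conn: "connected G"
  obtains \<zeta> where "\<And>v. v \<in> pverts G \<Longrightarrow> \<zeta> v \<noteq> 0"
    and "\<And>u p v. awalk u p v \<Longrightarrow> gain \<phi> p = complex_of_real (cmod (gain \<phi> p)) * \<zeta> v / \<zeta> u"
proof -
  \<comment> \<open>Connectedness includes the existence of a vertex; it serves as the root, and
    \<open>\<zeta> v\<close> is the phase of a chosen walk from it to \<open>v\<close>.\<close>
  obtain r where r: "r \<in> pverts G"
    using conn by (auto simp: connected_def strongly_connected_def)
  define path where "path v = (SOME p. awalk r p v)" for v
  have path: "awalk r (path v) v" if "v \<in> pverts G" for v
    unfolding path_def using someI_ex[OF connected_awalk[OF conn r that]] .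
  define \<zeta> where "\<zeta> v = sgn (gain \<phi> (path v))" for v
  have nz: "\<zeta> v \<noteq> 0" if "v \<in> pverts G" for v
    using gain_awalk_nonzero[OF path[OF that]] by (simp add: \<zeta>_def sgn_zero_iff)
  have "gain \<phi> p = complex_of_real (cmod (gain \<phi> p)) * \<zeta> v / \<zeta> u" if p: "awalk u p v" for u p v
  proof -
    have uv: "u \<in> pverts G" "v \<in> pverts G"
      using p awalk_hd_in_verts awalk_last_in_verts by auto
    \<comment> \<open>The same return walk \<open>s\<close> closes both \<open>path u @ p\<close>
      and \<open>path v\<close>. Both closed walks have phase 1, so comparing them cancels the phase
      of \<open>s\<close>.\<close>
    then obtain s where s: "awalk v s r"
      using connected_awalk[OF conn _ r] by blast
    have "sgn (gain \<phi> (path u @ p @ s)) = 1"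
      by (rule sgn_gain_closed_awalk[OF bal, of r]) (use path[OF uv(1)] p s in auto)
    moreover have "sgn (gain \<phi> (path v @ s)) = 1"
      by (rule sgn_gain_closed_awalk[OF bal, of r]) (use path[OF uv(2)] s in auto)
    ultimately have "\<zeta> u * sgn (gain \<phi> p) * sgn (gain \<phi> s) = \<zeta> v * sgn (gain \<phi> s)"
      by (simp add: \<zeta>_def sgn_mult mult.assoc)
    then have "\<zeta> u * sgn (gain \<phi> p) = \<zeta> v"
      using gain_awalk_nonzero[OF s] by (simp add: sgn_zero_iff)
    then have "sgn (gain \<phi> p) = \<zeta> v / \<zeta> u"
      using nz[OF uv(1)] by (simp add: nonzero_eq_divide_eq mult.commute)
    moreover have "gain \<phi> p = complex_of_real (cmod (gain \<phi> p)) * sgn (gain \<phi> p)"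
      using gain_awalk_nonzero[OF p] by (simp add: sgn_eq)
    ultimately show ?thesis by (metis times_divide_eq_right)
  qed
  with nz show thesis by (rule that)
qed

section \<open>Shortest paths\<close>

lemma finite_shortest_paths: "finite (shortest_paths G u v)"
  by (rule finite_subset[OF _ apaths_finite[of u v]]) (auto simp: shortest_paths_def)

lemma shortest_paths_nonempty:
  assumes "connected G" "u \<in> pverts G" "v \<in> pverts G"
  shows "shortest_paths G u v \<noteq> {}"
proof -
  obtain p where "apath u p v"
    using connected_awalk[OF assms] apath_awalk_to_apath by blast
  then have "\<exists>n p. apath u p v \<and> length p = n" by blast
  from LeastI_ex[OF this] show ?thesis
    by (auto simp: shortest_paths_def graph_dist_def)
qed

text \<open>Allows the distance factor to be cancelled when matrix entries are compared.\<close>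

lemma graph_dist_pos:
  assumes "connected G" "u \<in> pverts G" "v \<in> pverts G" "u \<noteq> v"
  shows "graph_dist G u v > 0"
proof (rule ccontr)
  assume "\<not> ?thesis"
  with shortest_paths_nonempty[OF assms(1-3)] have "apath u [] v"
    by (auto simp: shortest_paths_def)
  with \<open>u \<noteq> v\<close> show False by (simp add: apath_Nil_iff)
qed

lemma shortest_paths_arc:
  assumes "(u, v) \<in> parcs G"
  shows "[(u, v)] \<in> shortest_paths G u v" and "graph_dist G u v = 1"
proof -
  have "u \<noteq> v" using no_loops'[OF assms] .
  then have ap: "apath u [(u, v)] v"
    using assms in_arcsD2 by (auto simp: apath_Cons_iff apath_Nil_iff)
  have "graph_dist G u v = 1"
    unfolding graph_dist_def
  proof (rule Least_equality)
    show "\<exists>p. apath u p v \<and> length p = 1" using ap by force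
    show "1 \<le> n" if "\<exists>p. apath u p v \<and> length p = n" for n
      using that \<open>u \<noteq> v\<close> by (cases n) (auto simp: apath_Nil_iff)
  qed
  with ap show "[(u, v)] \<in> shortest_paths G u v" "graph_dist G u v = 1"
    by (auto simp: shortest_paths_def)
qed

end

section \<open>Entries and existence of the distance matrix\<close>

context
  fixes G :: "'a pair_pre_digraph" and \<phi> :: "'a \<times> 'a \<Rightarrow> complex" and vs :: "'a list"
  assumes csg: "conj_skew_gain_graph G \<phi>"
    and conn: "connected (with_proj G)"
    and vs: "set vs = pverts G"
begin

interpretation conj_skew_gain_graph G \<phi> by (rule csg)

text \<open>All vertices occur in \<open>vs\<close>, so equality of the matrices is equality of
  \<open>dist_max\<close> and \<open>dist_min\<close> at all pairs. Off the diagonal the distance is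
  nonzero, and a finite nonempty set of gains has equal extremes only if it is a singleton.\<close>

lemma D_exists_iff:
  "D_exists G vs \<phi> \<longleftrightarrow> (\<forall>u\<in>pverts G. \<forall>v\<in>pverts G. u \<noteq> v \<longrightarrow>
    (\<forall>p\<in>shortest_paths G u v. \<forall>q\<in>shortest_paths G u v. gain \<phi> p = gain \<phi> q))"
proof -
  have "D_exists G vs \<phi> \<longleftrightarrow>
      (\<forall>u\<in>pverts G. \<forall>v\<in>pverts G. dist_max G \<phi> u v = dist_min G \<phi> u v)"
    unfolding vs[symmetric]
    by (simp add: D_exists_def Dmax_def Dmin_def mat_eq_iff all_set_conv_all_nth)
  also have "\<dots> \<longleftrightarrow> (\<forall>u\<in>pverts G. \<forall>v\<in>pverts G. u \<noteq> v \<longrightarrow>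
    (\<forall>p\<in>shortest_paths G u v. \<forall>q\<in>shortest_paths G u v. gain \<phi> p = gain \<phi> q))"
  proof (intro ball_cong refl)
    fix u v assume uv: "u \<in> pverts G" "v \<in> pverts G"
    show "dist_max G \<phi> u v = dist_min G \<phi> u v \<longleftrightarrow> (u \<noteq> v \<longrightarrow>
      (\<forall>p\<in>shortest_paths G u v. \<forall>q\<in>shortest_paths G u v. gain \<phi> p = gain \<phi> q))"
      using graph_dist_pos[OF conn uv] shortest_paths_nonempty[OF conn uv]
        finite_shortest_paths[of u v] lex_Max_eq_lex_Min_iff[of "gain \<phi> ` shortest_paths G u v"]
      by (auto simp: dist_max_def dist_min_def)
  qed
  finally show ?thesis .
qed

lemma D_exists_imp_compatible: "D_exists G vs \<phi> \<Longrightarrow> modulus_distance_compatible G \<phi>"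
  unfolding D_exists_iff modulus_distance_compatible_def
  by (intro ballI impI arg_cong[of _ _ cmod]) blast

lemma nth_in_pverts: "i < length vs \<Longrightarrow> vs ! i \<in> pverts G"
  using nth_mem[of i vs] unfolding vs .

text \<open>All shortest paths share one gain, so the maximum runs over a singleton and any
  \<open>p\<close> computes the entry. The gains under \<open>abs_gain_fun \<phi>\<close> are the
  moduli of the same set, again a singleton.\<close>

lemma Dmat_index:
  assumes ex: "D_exists G vs \<phi>" and ij: "i < length vs" "j < length vs" and ne: "vs ! i \<noteq> vs ! j"
    and p: "p \<in> shortest_paths G (vs ! i) (vs ! j)"
  shows "Dmat G vs \<phi> $$ (i, j) = gain \<phi> p * of_nat (graph_dist G (vs ! i) (vs ! j))"
    and "Dmat G vs (abs_gain_fun \<phi>) $$ (i, j) =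
      complex_of_real (cmod (gain \<phi> p)) * of_nat (graph_dist G (vs ! i) (vs ! j))"
proof -
  have *: "gain \<phi> q = gain \<phi> p" if "q \<in> shortest_paths G (vs ! i) (vs ! j)" for q
    by (rule ex[unfolded D_exists_iff, rule_format, OF nth_in_pverts[OF ij(1)] nth_in_pverts[OF ij(2)] ne that p])
  have 1: "gain \<phi> ` shortest_paths G (vs ! i) (vs ! j) = {gain \<phi> p}"
    by (rule trans[OF image_cong[OF refl *] image_constant[OF p]])
  have "gain (abs_gain_fun \<phi>) ` shortest_paths G (vs ! i) (vs ! j)
      = (\<lambda>z. complex_of_real (cmod z)) ` gain \<phi> ` shortest_paths G (vs ! i) (vs ! j)"
    by (simp add: image_image gain_abs_gain_fun)
  then have 2: "gain (abs_gain_fun \<phi>) ` shortest_paths G (vs ! i) (vs ! j)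
      = {complex_of_real (cmod (gain \<phi> p))}"
    by (simp add: 1)
  have "lex_Max {z} = z" for z
    using lex_Max_in[of "{z}"] by simp
  then show "Dmat G vs \<phi> $$ (i, j) = gain \<phi> p * of_nat (graph_dist G (vs ! i) (vs ! j))"
    "Dmat G vs (abs_gain_fun \<phi>) $$ (i, j) =
      complex_of_real (cmod (gain \<phi> p)) * of_nat (graph_dist G (vs ! i) (vs ! j))"
    using ij ne by (simp_all add: Dmat_def Dmax_def dist_max_def 1 2)
qed

lemma Dmat_carrier: "Dmat G vs \<psi> \<in> carrier_mat (length vs) (length vs)"
  by (simp add: Dmat_def Dmax_def)

lemma Dmat_diag: "i < length vs \<Longrightarrow> j < length vs \<Longrightarrow> vs ! i = vs ! j \<Longrightarrow> Dmat G vs \<psi> $$ (i, j) = 0"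
  by (simp add: Dmat_def Dmax_def dist_max_def)

text \<open>The distance factor is a nonnegative real, so the modulus of an entry only changes its
  gain factor.\<close>

lemma Dmat_abs_gain_fun:
  assumes "D_exists G vs \<phi>"
  shows "Dmat G vs (abs_gain_fun \<phi>) = abs_mat (Dmat G vs \<phi>)"
proof (rule eq_matI)
  fix i j assume "i < dim_row (abs_mat (Dmat G vs \<phi>))" "j < dim_col (abs_mat (Dmat G vs \<phi>))"
  then have ij: "i < length vs" "j < length vs"
    using carrier_matD[OF abs_mat_carrier[OF Dmat_carrier]] by auto
  then have ab: "abs_mat (Dmat G vs \<phi>) $$ (i, j) = of_real (cmod (Dmat G vs \<phi> $$ (i, j)))"
    using carrier_matD[OF Dmat_carrier] by (simp add: abs_mat_def)
  show "Dmat G vs (abs_gain_fun \<phi>) $$ (i, j) = abs_mat (Dmat G vs \<phi>) $$ (i, j)"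
  proof (cases "vs ! i = vs ! j")
    case True
    then show ?thesis using ij ab by (simp add: Dmat_diag)
  next
    case False
    obtain p where "p \<in> shortest_paths G (vs ! i) (vs ! j)"
      using shortest_paths_nonempty[OF conn nth_in_pverts[OF ij(1)] nth_in_pverts[OF ij(2)]] by blast
    then show ?thesis
      using Dmat_index[OF assms ij False] ab by (simp add: norm_mult)
  qed
qed (use carrier_matD[OF abs_mat_carrier[OF Dmat_carrier]] carrier_matD[OF Dmat_carrier] in auto)

section \<open>From balance to existence and similarity\<close>

lemma balanced_imp_D_exists:
  assumes bal: "balanced G \<phi>" and "modulus_distance_compatible G \<phi>"
  shows "D_exists G vs \<phi>"
proof -
  obtain \<zeta> where \<zeta>: "\<And>u p v. awalk u p v \<Longrightarrow> gain \<phi> p = complex_of_real (cmod (gain \<phi> p)) * \<zeta> v / \<zeta> u"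
    using balanced_potential[OF bal conn] by metis
  show ?thesis
    unfolding D_exists_iff
  proof (intro ballI impI)
    fix u v p q assume uv: "u \<in> pverts G" "v \<in> pverts G" "u \<noteq> v"
      and p: "p \<in> shortest_paths G u v" and q: "q \<in> shortest_paths G u v"
    have pq: "awalk u p v" "awalk u q v"
      using p q by (auto simp: shortest_paths_def apath_def)
    \<comment> \<open>Compatibility equates the moduli; the phase
      \<open>\<zeta> v / \<zeta> u\<close> depends on the end points alone.\<close>
    have "cmod (gain \<phi> p) = cmod (gain \<phi> q)"
      by (rule assms(2)[unfolded modulus_distance_compatible_def, rule_format, OF uv p q])
    then have "complex_of_real (cmod (gain \<phi> p)) * \<zeta> v / \<zeta> u
        = complex_of_real (cmod (gain \<phi> q)) * \<zeta> v / \<zeta> u"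
      by (rule arg_cong)
    then show "gain \<phi> p = gain \<phi> q"
      unfolding \<zeta>[OF pq(1), symmetric] \<zeta>[OF pq(2), symmetric] .
  qed
qed

lemma balanced_imp_similar:
  assumes bal: "balanced G \<phi>" and ex: "D_exists G vs \<phi>"
  shows "similar_mat (Dmat G vs \<phi>) (Dmat G vs (abs_gain_fun \<phi>))"
proof -
  obtain \<zeta> where nz: "\<And>v. v \<in> pverts G \<Longrightarrow> \<zeta> v \<noteq> 0"
    and \<zeta>: "\<And>u p v. awalk u p v \<Longrightarrow> gain \<phi> p = complex_of_real (cmod (gain \<phi> p)) * \<zeta> v / \<zeta> u"
    using balanced_potential[OF bal conn] by metis
  define n where "n = length vs"
  \<comment> \<open>Entry \<open>(i, j)\<close> of \<open>?A\<close> is that of \<open>?B\<close>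
    times \<open>\<zeta> (vs ! j) / \<zeta> (vs ! i)\<close>: rows are scaled by the inverse of
    \<open>\<zeta>\<close>, columns by \<open>\<zeta>\<close>.\<close>
  define P where "P = mat_diag n (\<lambda>i. inverse (\<zeta> (vs ! i)))"
  define Q where "Q = mat_diag n (\<lambda>i. \<zeta> (vs ! i))"
  have nz': "\<zeta> (vs ! i) \<noteq> 0" if "i < n" for i
    by (rule nz[OF nth_in_pverts]) (use that in \<open>simp add: n_def\<close>)
  let ?A = "Dmat G vs \<phi>" and ?B = "Dmat G vs (abs_gain_fun \<phi>)"
  have carr: "?A \<in> carrier_mat n n" "?B \<in> carrier_mat n n"
    unfolding n_def by (rule Dmat_carrier)+
  have "?A = P * ?B * Q"
  proof (rule eq_matI)
    fix i j assume "i < dim_row (P * ?B * Q)" "j < dim_col (P * ?B * Q)"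
    then have ij: "i < n" "j < n" by (simp_all add: P_def Q_def mat_diag_def)
    have "(P * ?B * Q) $$ (i, j) = inverse (\<zeta> (vs ! i)) * ?B $$ (i, j) * \<zeta> (vs ! j)"
      using ij unfolding P_def Q_def mat_diag_mult_left[OF carr(2)]
      by (subst mat_diag_mult_right[of _ n]) auto
    also have "\<dots> = ?A $$ (i, j)"
    proof (cases "vs ! i = vs ! j")
      case True
      then show ?thesis using ij by (simp add: Dmat_diag n_def)
    next
      case False
      obtain p where p: "p \<in> shortest_paths G (vs ! i) (vs ! j)"
        using shortest_paths_nonempty[OF conn nth_in_pverts nth_in_pverts] ij unfolding n_def by blast
      then have walk: "awalk (vs ! i) p (vs ! j)"
        by (auto simp: shortest_paths_def apath_def)
      define a where "a = complex_of_real (cmod (gain \<phi> p))"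
      have "gain \<phi> p = a * \<zeta> (vs ! j) / \<zeta> (vs ! i)"
        unfolding a_def by (rule \<zeta>[OF walk])
      moreover note Dmat_index[OF ex ij[unfolded n_def] False p, folded a_def]
      ultimately show ?thesis
        using nz'[OF ij(1)] by (simp add: field_simps)
    qed
    finally show "?A $$ (i, j) = (P * ?B * Q) $$ (i, j)" by simp
  qed (use carr in \<open>auto simp: P_def Q_def mat_diag_def\<close>)
  moreover have "P * Q = 1\<^sub>m n" "Q * P = 1\<^sub>m n"
    unfolding P_def Q_def mat_diag_diag
    by (auto simp: mat_diag_def nz' intro!: eq_matI)
  ultimately show ?thesis
    using carr by (intro similar_matI[of _ _ P Q n]) (auto simp: P_def Q_def)
qed

section \<open>From cospectrality to balance\<close>

lemma cospectral_imp_balanced: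
  assumes ex: "D_exists G vs \<phi>" and cosp: "cospectral (Dmat G vs \<phi>) (Dmat G vs (abs_gain_fun \<phi>))"
  shows "balanced G \<phi>"
  unfolding balanced_def oriented_cycle_def
proof (intro allI impI, elim conjE)
  fix c assume "cycle c"
  then obtain u where c: "awalk u c u" "c \<noteq> []" by (auto simp: cycle_def)
  define w where "w = awalk_verts u c"
  define k where "k = length c"
  have w: "length w = Suc k" "set w \<subseteq> pverts G" "w ! 0 = u" "w ! k = u"
    using c length_awalk_verts[of u c] awalk_verts_non_Nil[of u c]
    by (auto simp: w_def k_def awalk_conv hd_conv_nth last_conv_nth)
  have arcs: "c ! t = (w ! t, w ! Suc t)" if "t < k" for t
  proof -
    have "w ! t = fst (c ! t)"
      using that c by (simp add: w_def k_def awalk_verts_conv nth_append)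
    moreover have "w ! Suc t = snd (c ! t)"
      using that c awalk_verts_conv'[of u c u] by (auto simp: w_def k_def)
    ultimately show ?thesis by simp
  qed
  \<comment> \<open>Matrix entries are addressed by positions in \<open>vs\<close>, so the vertices
    of the cycle are turned into indices.\<close>
  define f where "f t = (SOME i. i < length vs \<and> vs ! i = w ! t)" for t
  have f: "f t < length vs" "vs ! f t = w ! t" if "t \<le> k" for t
  proof -
    have "w ! t \<in> set vs"
      unfolding vs by (rule subsetD[OF w(2) nth_mem]) (use that w(1) in simp)
    then have "\<exists>i. i < length vs \<and> vs ! i = w ! t" by (simp add: in_set_conv_nth)
    from someI_ex[OF this] show "f t < length vs" "vs ! f t = w ! t"
      by (auto simp: f_def)
  qed
  \<comment> \<open>A single arc is a shortest path and has distance 1, so the entry is the gain of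
    the arc with no further factor.\<close>
  have "Dmat G vs \<phi> $$ (f t, f (Suc t)) = \<phi> (c ! t)" if "t < k" for t
  proof -
    have arc: "(w ! t, w ! Suc t) \<in> parcs G"
      using c(1) that arcs[OF that] nth_mem[of t c] by (auto simp: awalk_def k_def)
    then show ?thesis
      using Dmat_index(1)[OF ex, of "f t" "f (Suc t)" "[(w ! t, w ! Suc t)]"]
        shortest_paths_arc[OF arc] no_loops'[OF arc] f[of t] f[of "Suc t"] that
      by (simp add: arcs)
  qed
  moreover have "gain \<phi> c = (\<Prod>t<k. \<phi> (c ! t))"
    by (simp add: gain_def k_def prod.list_conv_set_nth lessThan_atLeast0)
  moreover have "(\<Prod>t<k. Dmat G vs \<phi> $$ (f t, f (Suc t)))
      = of_real (cmod (\<Prod>t<k. Dmat G vs \<phi> $$ (f t, f (Suc t))))"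
  proof (rule closed_walk_product_nonneg[OF Dmat_carrier])
    show "mat_trace (Dmat G vs \<phi> ^\<^sub>m k) = mat_trace (abs_mat (Dmat G vs \<phi>) ^\<^sub>m k)"
      using cospectral_mat_trace_pow[OF Dmat_carrier Dmat_carrier cosp]
      by (simp add: Dmat_abs_gain_fun[OF ex])
    \<comment> \<open>Both sides are the same choice, because \<open>w ! k\<close> and
      \<open>w ! 0\<close> are the same vertex \<open>u\<close>.\<close>
    show "f k = f 0" by (simp add: f_def w)
  qed (rule f)
  ultimately show "gain \<phi> c = complex_of_real (cmod (gain \<phi> c))" by simp
qed

end

theorem theorem4p7:
  fixes G :: "'a pair_pre_digraph"
    and \<phi> :: "'a \<times> 'a \<Rightarrow> complex"
    and vs :: "'a list"
  assumes "conj_skew_gain_graph G \<phi>"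
    and "Digraph_Component.connected (with_proj G)"
    and "distinct vs" and "set vs = pverts G"
  shows "balanced G \<phi> \<and> modulus_distance_compatible G \<phi> \<longleftrightarrow>
    D_exists G vs \<phi> \<and> cospectral (Dmat G vs \<phi>) (Dmat G vs (abs_gain_fun \<phi>))"
proof
  assume *: "balanced G \<phi> \<and> modulus_distance_compatible G \<phi>"
  then have "D_exists G vs \<phi>"
    using balanced_imp_D_exists[OF assms(1,2,4)] by blast
  with * show "D_exists G vs \<phi> \<and> cospectral (Dmat G vs \<phi>) (Dmat G vs (abs_gain_fun \<phi>))"
    using balanced_imp_similar[OF assms(1,2,4)] cospectral_similar by blast
next
  assume *: "D_exists G vs \<phi> \<and> cospectral (Dmat G vs \<phi>) (Dmat G vs (abs_gain_fun \<phi>))"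
  then show "balanced G \<phi> \<and> modulus_distance_compatible G \<phi>"
    using cospectral_imp_balanced[OF assms(1,2,4)] D_exists_imp_compatible[OF assms(1,2,4)] by blast
qed

end
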